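(* There is no nfs-irreducible clause-irreducible unsatisfiable hitting clause-set of deficiency $3$. Equivalently: for every clause-irreducible unsatisfiable hitting clause-set $F$ with $\delta(F)=3$, there is a finite sequence of nfs-flips transforming $F$ into a clause-reducible clause-set.
   Context: Variables are positive integers, literals are nonzero integers, the complement of a literal $x$ is $\overline{x}=-x$, and $\mathrm{var}(x)=|x|$. A clause is a finite set $C$ of literals with no pair $x,\overline{x}$; $\bot$ is the empty clause. A clause-set is a finite set of clauses; $\top$ denotes the empty clause-set. $\mathrm{var}(F)$ is the set of variables occurring in $F$, $n(F)=|\mathrm{var}(F)|$, $c(F)=|F|$, $\delta(F)=c(F)-n(F)$. $F$ is satisfiable if some clause $C$ satisfies $C\cap D\ne\emptyset$ for all $D\in F$, otherwise unsatisfiable. $F$ is hitting if any two distinct clauses $C,D\in F$ have some $x\in C$ with $\overline{x}\in D$. A clause-factor is a clause-set $F'\neq\top$ such that the residue $\{C\setminus\bigcap F': C\in F'\}$ is unsatisfiable; a clause-factor of $F$ is a subset $F'\subseteq F$ that is a clause-factor. It is trivial if $c(F')=1$, or if $F'$ is unsatisfiable and $F'=F$; otherwise nontrivial. $F$ is clause-irreducible if all its clause-factors are trivial, otherwise clause-reducible. An nfs-pair is a set $\{E\cup\{x\},E\cup\{\overline{x},y\}\}$ of two clauses where $E$ is a clause, $x,y$ are literals with $\mathrm{var}(x)\ne\mathrm{var}(y)$ and $x,\overline x,y,\overline y\notin E$; its nfs-flip is $\{E\cup\{x,\overline{y}\},E\cup\{y\}\}$. Performing an nfs-flip on a clause-set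 $F$ means choosing an nfs-pair $P\subseteq F$ such that neither clause of its nfs-flip belongs to $F$, and replacing $P$ in $F$ by its nfs-flip. A clause-irreducible unsatisfiable hitting clause-set is nfs-reducible if some finite sequence of nfs-flips transforms it into a clause-reducible clause-set, and nfs-irreducible otherwise. *)

theory Defs
  imports Main
begin

definition is_literal :: "int \<Rightarrow> bool" where
  "is_literal x \<longleftrightarrow> x \<noteq> 0"

definition is_clause :: "int set \<Rightarrow> bool" where
  "is_clause C \<longleftrightarrow> finite C \<and> (\<forall>x\<in>C. is_literal x \<and> - x \<notin> C)"

definition clause_set :: "int set set \<Rightarrow> bool" where
  "clause_set F \<longleftrightarrow> finite F \<and> (\<forall>C\<in>F. is_clause C)"

definition vars :: "int set set \<Rightarrow> int set" where
  "vars F = abs ` \<Union>F"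

definition deficiency :: "int set set \<Rightarrow> int" where
  "deficiency F = int (card F) - int (card (vars F))"

definition satisfiable :: "int set set \<Rightarrow> bool" where
  "satisfiable F \<longleftrightarrow> (\<exists>C. is_clause C \<and> (\<forall>D\<in>F. C \<inter> D \<noteq> {}))"

abbreviation unsatisfiable :: "int set set \<Rightarrow> bool" where
  "unsatisfiable F \<equiv> \<not> satisfiable F"

definition hitting :: "int set set \<Rightarrow> bool" where
  "hitting F \<longleftrightarrow> (\<forall>C\<in>F. \<forall>D\<in>F. C \<noteq> D \<longrightarrow> (\<exists>x\<in>C. - x \<in> D))"

definition residue :: "int set set \<Rightarrow> int set set" where
  "residue F = {C - \<Inter>F | C. C \<in> F}"

definition clause_factor :: "int set set \<Rightarrow> bool" where
  "clause_factor F \<longleftrightarrow> clause_set F \<and> F \<noteq> {} \<and> unsatisfiable (residue F)"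

definition clause_factor_of :: "int set set \<Rightarrow> int set set \<Rightarrow> bool" where
  "clause_factor_of F' F \<longleftrightarrow> F' \<subseteq> F \<and> clause_factor F'"

definition trivial_factor_of :: "int set set \<Rightarrow> int set set \<Rightarrow> bool" where
  "trivial_factor_of F' F \<longleftrightarrow> card F' = 1 \<or> (unsatisfiable F' \<and> F' = F)"

definition clause_irreducible :: "int set set \<Rightarrow> bool" where
  "clause_irreducible F \<longleftrightarrow> (\<forall>F'. clause_factor_of F' F \<longrightarrow> trivial_factor_of F' F)"

abbreviation clause_reducible :: "int set set \<Rightarrow> bool" where
  "clause_reducible F \<equiv> \<not> clause_irreducible F"

text \<open>\<open>nfs_pair_flip P Q\<close>: \<open>P\<close> is an nfs-pair and \<open>Q\<close> is its nfs-flip.\<close>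

definition nfs_pair_flip :: "int set set \<Rightarrow> int set set \<Rightarrow> bool" where
  "nfs_pair_flip P Q \<longleftrightarrow>
    (\<exists>E x y. is_clause E \<and> is_literal x \<and> is_literal y \<and> \<bar>x\<bar> \<noteq> \<bar>y\<bar> \<and>
       x \<notin> E \<and> - x \<notin> E \<and> y \<notin> E \<and> - y \<notin> E \<and>
       P = {E \<union> {x}, E \<union> {- x, y}} \<and> Q = {E \<union> {x, - y}, E \<union> {y}})"

definition nfs_flip_step :: "int set set \<Rightarrow> int set set \<Rightarrow> bool" where
  "nfs_flip_step F G \<longleftrightarrow>
    (\<exists>P Q. nfs_pair_flip P Q \<and> P \<subseteq> F \<and> Q \<inter> F = {} \<and> G = (F - P) \<union> Q)"

definition nfs_reducible :: "int set set \<Rightarrow> bool" where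
  "nfs_reducible F \<longleftrightarrow> (\<exists>G. nfs_flip_step\<^sup>*\<^sup>* F G \<and> clause_reducible G)"

abbreviation nfs_irreducible :: "int set set \<Rightarrow> bool" where
  "nfs_irreducible F \<equiv> \<not> nfs_reducible F"

end

theory Submission
  imports Defs
begin

text \<open>
  Read a clause as the cube of all total assignments containing it; an unsatisfiable hitting
  clause-set is then a partition of the cube of all assignments. Let \<open>v\<close> be a variable of minimal
  degree. Setting a literal \<open>x\<close> of \<open>v\<close> loses no variable besides \<open>v\<close>, so induction on the number of
  variables gives that \<open>x\<close> occurs at most \<open>\<delta>(F)\<close> times. For \<open>\<delta>(F) = 3\<close> both literals of
  \<open>v\<close> thus occur at most three times. If both occurred three times, setting \<open>v\<close> would leave a
  clause-set of deficiency \<open>1\<close>, in which some variable occurs only twice; that variable would have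
  degree at most \<open>5\<close> in \<open>F\<close>, contradicting the minimality of \<open>v\<close>.

  So some literal \<open>x\<close> of \<open>v\<close> occurs at most twice and \<open>-x\<close> at most three times. After deletion
  of \<open>x\<close> and \<open>-x\<close>, the clauses containing \<open>x\<close> and those containing \<open>-x\<close> cover the same region,
  and two cubes covering the same region as at most three cubes leave so few configurations that
  each yields a clause-factor, either at once or after a single nfs-flip.
\<close>

section \<open>Total assignments and the cubes of clauses\<close>

definition consistent :: "int set \<Rightarrow> bool" where
  "consistent S \<longleftrightarrow> (\<forall>x\<in>S. x \<noteq> 0 \<and> - x \<notin> S)"

definition total_asg :: "int set \<Rightarrow> bool" where
  "total_asg p \<longleftrightarrow> consistent p \<and> (\<forall>x. x \<noteq> 0 \<longrightarrow> x \<in> p \<or> - x \<in> p)"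

definition set_lit :: "int \<Rightarrow> int set \<Rightarrow> int set" where
  "set_lit z p = insert z (p - {- z})"

text \<open>The inclusion \<open>C \<subseteq> p\<close> says that the negation of \<open>p\<close>
  falsifies \<open>C\<close>. Having such a clause for every \<open>p\<close> expresses
  unsatisfiability; having only one expresses hitting.\<close>

definition uhit :: "int set set \<Rightarrow> bool" where
  "uhit F \<longleftrightarrow> clause_set F \<and> (\<forall>p. total_asg p \<longrightarrow> (\<exists>!C. C \<in> F \<and> C \<subseteq> p))"

text \<open>The condition \<open>x \<notin> C\<close> makes \<open>insert x\<close> injective, so
  these residual clauses correspond one to one to the clauses containing \<open>x\<close>.\<close>

definition proj :: "int set set \<Rightarrow> int \<Rightarrow> int set set" where
  "proj F x = {C. x \<notin> C \<and> insert x C \<in> F}"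

lemma is_clause_consistent: "is_clause C \<Longrightarrow> consistent C"
  by (auto simp: is_clause_def consistent_def is_literal_def)

lemma consistent_subset: "consistent S \<Longrightarrow> T \<subseteq> S \<Longrightarrow> consistent T"
  by (auto simp: consistent_def)

lemma consistent_insert:
  "consistent S \<Longrightarrow> z \<noteq> 0 \<Longrightarrow> - z \<notin> S \<Longrightarrow> consistent (insert z S)"
  by (auto simp: consistent_def)

lemma consistent_override:
  "consistent S \<Longrightarrow> consistent T \<Longrightarrow> consistent (S \<union> {- t |t. t \<in> T \<and> t \<notin> S})"
  by (auto simp: consistent_def)

lemma total_consistent: "total_asg p \<Longrightarrow> consistent p"
  by (simp add: total_asg_def)

lemma totalD: "total_asg p \<Longrightarrow> x \<in> p \<Longrightarrow> - x \<notin> p"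
  using total_consistent by (auto simp: consistent_def)

lemma total_nonzero: "total_asg p \<Longrightarrow> x \<in> p \<Longrightarrow> x \<noteq> 0"
  using total_consistent by (auto simp: consistent_def)

lemma total_uminus_iff: "total_asg p \<Longrightarrow> x \<noteq> 0 \<Longrightarrow> - x \<in> p \<longleftrightarrow> x \<notin> p"
  using totalD unfolding total_asg_def by blast

lemma total_set_lit: "total_asg p \<Longrightarrow> z \<noteq> 0 \<Longrightarrow> total_asg (set_lit z p)"
  unfolding total_asg_def consistent_def set_lit_def
  by (metis Diff_iff add.inverse_inverse empty_iff insert_iff neg_equal_zero)

lemma not_in_set_lit: "z \<noteq> 0 \<Longrightarrow> - z \<notin> set_lit z p"
  by (simp add: set_lit_def)

lemma exists_total:
  assumes "consistent S"
  obtains p where "total_asg p" "S \<subseteq> p"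
proof
  \<comment> \<open>Variables left undecided by \<open>S\<close> receive their positive literal by
    default.\<close>
  let ?p = "S \<union> {x. x > 0 \<and> x \<notin> S \<and> - x \<notin> S}"
  show "S \<subseteq> ?p" by auto
  show "total_asg ?p"
    unfolding total_asg_def
  proof (intro conjI allI impI)
    show "consistent ?p" using assms by (auto simp: consistent_def)
    fix x :: int assume "x \<noteq> 0"
    then show "x \<in> ?p \<or> - x \<in> ?p" by (cases "x > 0") auto
  qed
qed

text \<open>A literal of \<open>T\<close> missing from \<open>S\<close> could be negated in some
  assignment extending \<open>S\<close>, and that assignment would not contain
  \<open>T\<close>.\<close>

lemma subset_if_total:
  assumes S: "consistent S" and T: "\<And>p. total_asg p \<Longrightarrow> S \<subseteq> p \<Longrightarrow> T \<subseteq> p"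
  shows "T \<subseteq> S"
proof
  fix t assume t: "t \<in> T"
  show "t \<in> S"
  proof (rule ccontr)
    assume n: "t \<notin> S"
    obtain p where p: "total_asg p" "S \<subseteq> p" using exists_total[OF S] .
    have "t \<in> p" using T[OF p] t by auto
    then have t0: "t \<noteq> 0" using total_nonzero[OF p(1)] by blast
    have "consistent (insert (- t) S)" using S n t0 by (intro consistent_insert) auto
    then obtain q where q: "total_asg q" "insert (- t) S \<subseteq> q" by (rule exists_total)
    then have "t \<in> q" using T[of q] t by auto
    then show False using q totalD[of q t] by auto
  qed
qed

lemma exists_clash:
  assumes "consistent U" "consistent V" "\<And>p. total_asg p \<Longrightarrow> \<not> (U \<subseteq> p \<and> V \<subseteq> p)"
  obtains l where "l \<in> U" "- l \<in> V"
proof -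
  have "\<not> consistent (U \<union> V)" using assms(3) by (meson exists_total le_sup_iff)
  then obtain l where "l \<in> U \<union> V" "l = 0 \<or> - l \<in> U \<union> V" by (auto simp: consistent_def)
  then have "\<exists>l. l \<in> U \<and> - l \<in> V"
    using assms(1,2) unfolding consistent_def by (metis UnE add.inverse_inverse)
  then show thesis using that by blast
qed

text \<open>Disjoint cubes clash in some literal \<open>l\<close>. On the half of \<open>E\<close>
  where \<open>l\<close> holds \<open>V\<close> fails, so \<open>U\<close> is this entire half;
  symmetrically \<open>V\<close> is the other half.\<close>

lemma two_cubes_partition:
  assumes U: "consistent U" and V: "consistent V"
    and cover: "\<And>p. total_asg p \<Longrightarrow> E \<subseteq> p \<longleftrightarrow> U \<subseteq> p \<or> V \<subseteq> p"
    and disj: "\<And>p. total_asg p \<Longrightarrow> \<not> (U \<subseteq> p \<and> V \<subseteq> p)"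
  obtains l where "l \<noteq> 0" "l \<notin> E" "- l \<notin> E" "U = insert l E" "V = insert (- l) E"
proof -
  have EU: "E \<subseteq> U" by (rule subset_if_total[OF U]) (simp add: cover)
  have EV: "E \<subseteq> V" by (rule subset_if_total[OF V]) (simp add: cover)
  obtain l where l: "l \<in> U" "- l \<in> V" using exists_clash[OF U V disj] .
  have l0: "l \<noteq> 0" using l U by (auto simp: consistent_def)
  have nl: "l \<notin> E" "- l \<notin> E" using l U V EU EV by (auto simp: consistent_def)
  have "consistent (insert l E)" using EU l U consistent_subset by blast
  then have 1: "U \<subseteq> insert l E"
  proof (rule subset_if_total)
    fix p assume p: "total_asg p" "insert l E \<subseteq> p"
    then have "\<not> V \<subseteq> p" using l totalD[of p l] by auto
    then show "U \<subseteq> p" using cover[OF p(1)] p by auto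
  qed
  have "consistent (insert (- l) E)" using EV l V consistent_subset by blast
  then have 2: "V \<subseteq> insert (- l) E"
  proof (rule subset_if_total)
    fix p assume p: "total_asg p" "insert (- l) E \<subseteq> p"
    then have "\<not> U \<subseteq> p" using l totalD[of p l] by auto
    then show "V \<subseteq> p" using cover[OF p(1)] p by auto
  qed
  show thesis using that[OF l0 nl] 1 2 EU EV l by auto
qed

text \<open>Take \<open>a\<close> in \<open>C1\<close> outside \<open>D\<close>. On the half of
  \<open>D\<close> where \<open>a\<close> fails, only \<open>C2\<close> can cover, so
  \<open>C2\<close> lies in \<open>D\<close> except for the literal \<open>- a\<close>. Exchanging
  the roles of \<open>C1\<close> and \<open>C2\<close> shows that \<open>a\<close> is the only
  literal of \<open>C1\<close> outside \<open>D\<close>.\<close>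

lemma cube_in_two_cubes:
  assumes D: "consistent D"
    and cover: "\<And>p. total_asg p \<Longrightarrow> D \<subseteq> p \<Longrightarrow> C1 \<subseteq> p \<or> C2 \<subseteq> p"
    and n: "\<not> C1 \<subseteq> D" "\<not> C2 \<subseteq> D"
  obtains y where "y \<in> C1" "- y \<in> C2" "C1 - {y} \<subseteq> D" "C2 - {- y} \<subseteq> D" "y \<notin> D" "- y \<notin> D"
proof -
  have step: "- a \<notin> D \<and> - a \<in> C2' \<and> C2' - {- a} \<subseteq> D"
    if cov: "\<And>p. total_asg p \<Longrightarrow> D \<subseteq> p \<Longrightarrow> C1' \<subseteq> p \<or> C2' \<subseteq> p"
      and n2: "\<not> C2' \<subseteq> D" and a: "a \<in> C1'" "a \<notin> D" for a C1' C2'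
  proof -
    have ex: "\<exists>p. total_asg p \<and> D \<subseteq> p \<and> a \<in> p"
    proof (rule ccontr)
      assume n: "\<not> ?thesis"
      have "C2' \<subseteq> D"
      proof (rule subset_if_total[OF D])
        fix p assume p: "total_asg p" "D \<subseteq> p"
        then have "\<not> C1' \<subseteq> p" using n a by blast
        then show "C2' \<subseteq> p" using cov[OF p] by blast
      qed
      then show False using n2 by simp
    qed
    then have a': "- a \<notin> D" and a0: "a \<noteq> 0" using totalD total_nonzero by blast+
    have "consistent (insert (- a) D)" using D a0 a by (intro consistent_insert) auto
    then have "C2' \<subseteq> insert (- a) D"
    proof (rule subset_if_total)
      fix p assume p: "total_asg p" "insert (- a) D \<subseteq> p"
      then have "a \<notin> p" using totalD[of p a] by blast
      then show "C2' \<subseteq> p" using cov[of p] p a by blast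
    qed
    then show ?thesis using n2 a' by auto
  qed
  obtain a where a: "a \<in> C1" "a \<notin> D" using n by auto
  have 1: "- a \<notin> D \<and> - a \<in> C2 \<and> C2 - {- a} \<subseteq> D" using step[OF cover n(2) a] .
  have "- (- a) \<notin> D \<and> - (- a) \<in> C1 \<and> C1 - {- (- a)} \<subseteq> D"
    by (rule step[where C1' = C2]) (use cover n 1 in auto)
  then show thesis using that[of a] 1 by auto
qed

section \<open>Unsatisfiable hitting clause-sets and the two sides of a literal\<close>

lemma uhitI:
  assumes F: "clause_set F" and u: "unsatisfiable F" and h: "hitting F"
  shows "uhit F"
  unfolding uhit_def
proof (intro conjI allI impI F)
  fix p assume p: "total_asg p"
  have "\<exists>C. C \<in> F \<and> C \<subseteq> p"
  proof (rule ccontr)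
    assume n: "\<not> ?thesis"
    \<comment> \<open>The negation of \<open>p\<close>, cut down to literals of \<open>F\<close> and
      their complements so that it is finite. If no clause lay inside \<open>p\<close>, this clause
      would satisfy \<open>F\<close>.\<close>
    let ?S = "{x \<in> \<Union>F \<union> uminus ` \<Union>F. - x \<in> p}"
    have "finite (\<Union>F)" using F by (auto simp: clause_set_def is_clause_def)
    then have "finite (\<Union>F \<union> uminus ` \<Union>F)" by simp
    then have "finite ?S" by (rule rev_finite_subset) blast
    moreover have "x \<noteq> 0 \<and> - x \<notin> ?S" if "x \<in> ?S" for x
      using that totalD[OF p, of "- x"] total_nonzero[OF p, of "- x"] by simp
    ultimately have "is_clause ?S" by (simp add: is_clause_def is_literal_def)
    moreover have "\<forall>D\<in>F. ?S \<inter> D \<noteq> {}"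
    proof
      fix D assume D: "D \<in> F"
      then obtain d where d: "d \<in> D" "d \<notin> p" using n by auto
      have "d \<noteq> 0" using F D d by (auto simp: clause_set_def is_clause_def is_literal_def)
      then have "- d \<in> p" using total_uminus_iff[OF p] d by blast
      then show "?S \<inter> D \<noteq> {}" using d D by blast
    qed
    ultimately show False using u by (auto simp: satisfiable_def)
  qed
  moreover have "C = D" if "C \<in> F \<and> C \<subseteq> p" "D \<in> F \<and> D \<subseteq> p" for C D
    using h that totalD[OF p] unfolding hitting_def by (metis in_mono)
  ultimately show "\<exists>!C. C \<in> F \<and> C \<subseteq> p" by blast
qed

context
  fixes F assumes F: "uhit F"
begin

lemma uhit_clause: "C \<in> F \<Longrightarrow> is_clause C"
  using F by (auto simp: uhit_def clause_set_def)

lemma uhit_finite: "finite F"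
  using F by (auto simp: uhit_def clause_set_def)

lemma uhit_ex: "total_asg p \<Longrightarrow> \<exists>C\<in>F. C \<subseteq> p"
  using F unfolding uhit_def by blast

lemma uhit_unique: "total_asg p \<Longrightarrow> C \<in> F \<Longrightarrow> D \<in> F \<Longrightarrow> C \<subseteq> p \<Longrightarrow> D \<subseteq> p \<Longrightarrow> C = D"
  using F unfolding uhit_def by blast

lemma uhit_subset_eq: "C \<in> F \<Longrightarrow> D \<in> F \<Longrightarrow> C \<subseteq> D \<Longrightarrow> C = D"
  by (meson exists_total is_clause_consistent order_trans uhit_clause uhit_unique)

lemma projD:
  assumes "C \<in> proj F x"
  shows "insert x C \<in> F" "consistent C" "x \<notin> C" "- x \<notin> C" "x \<noteq> 0"
proof -
  show 1: "insert x C \<in> F" and 2: "x \<notin> C" using assms by (auto simp: proj_def)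
  have c: "consistent (insert x C)" using uhit_clause[OF 1] by (rule is_clause_consistent)
  then show "consistent C" "x \<noteq> 0" "- x \<notin> C" by (auto simp: consistent_def)
qed

lemma proj_unique:
  assumes p: "total_asg p" and C: "C \<in> proj F x" "C \<subseteq> p" and D: "D \<in> proj F x" "D \<subseteq> p"
  shows "C = D"
proof -
  have "insert x C \<subseteq> set_lit x p" "insert x D \<subseteq> set_lit x p"
    using C D projD(4) by (auto simp: set_lit_def)
  then have "insert x C = insert x D"
    using uhit_unique[OF total_set_lit[OF p projD(5)[OF C(1)]] projD(1)[OF C(1)] projD(1)[OF D(1)]]
    by simp
  then show ?thesis using projD(3)[OF C(1)] projD(3)[OF D(1)] by (simp add: insert_ident)
qed

text \<open>Make \<open>x\<close> false in \<open>p\<close> and take the clause \<open>D\<close>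
  inside the result. If \<open>D\<close> avoided \<open>- x\<close>, it would also lie inside
  \<open>p\<close> with \<open>x\<close> made true, where \<open>insert x C\<close> is already the
  unique clause. Hence the two sides of \<open>x\<close> cover the same region.\<close>

lemma proj_swap_imp:
  assumes p: "total_asg p" and C: "C \<in> proj F x" "C \<subseteq> p"
  shows "\<exists>D\<in>proj F (- x). D \<subseteq> p"
proof -
  have x: "x \<noteq> 0" using projD[OF C(1)] by simp
  let ?q = "set_lit (- x) p"
  have q: "total_asg ?q" using total_set_lit[OF p] x by simp
  obtain D where D: "D \<in> F" "D \<subseteq> ?q" using uhit_ex[OF q] by auto
  have "- x \<in> D"
  proof (rule ccontr)
    assume n: "- x \<notin> D"
    have "x \<notin> D" using D not_in_set_lit[of "- x" p] x by auto
    then have "D \<subseteq> set_lit x p" using D n by (auto simp: set_lit_def)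
    moreover have "insert x C \<subseteq> set_lit x p" using C projD(4) by (auto simp: set_lit_def)
    ultimately have "D = insert x C"
      using uhit_unique[OF total_set_lit[OF p x]] D projD(1)[OF C(1)] by blast
    then show False using \<open>x \<notin> D\<close> by simp
  qed
  then have "D - {- x} \<in> proj F (- x)" using D by (simp add: proj_def insert_absorb)
  moreover have "D - {- x} \<subseteq> p" using D by (auto simp: set_lit_def)
  ultimately show ?thesis by blast
qed

lemma proj_swap: "total_asg p \<Longrightarrow> (\<exists>C\<in>proj F x. C \<subseteq> p) \<longleftrightarrow> (\<exists>D\<in>proj F (- x). D \<subseteq> p)"
  using proj_swap_imp[of p _ x] proj_swap_imp[of p _ "- x"] by auto

lemma bij_proj: "bij_betw (insert x) (proj F x) {C \<in> F. x \<in> C}"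
proof (rule bij_betw_imageI)
  show "inj_on (insert x) (proj F x)"
    using projD(3) by (auto simp: inj_on_def insert_ident)
  show "insert x ` proj F x = {C \<in> F. x \<in> C}"
  proof (intro equalityI subsetI)
    fix C assume "C \<in> {C \<in> F. x \<in> C}"
    then have "C = insert x (C - {x})" "C - {x} \<in> proj F x"
      by (auto simp: proj_def insert_absorb)
    then show "C \<in> insert x ` proj F x" by (rule image_eqI)
  qed (auto simp: proj_def)
qed

lemma card_proj: "card (proj F x) = card {C \<in> F. x \<in> C}"
  using bij_betw_same_card[OF bij_proj] .

lemma finite_proj: "finite (proj F x)"
  using bij_betw_finite[OF bij_proj[of x]] uhit_finite by simp

end

section \<open>Clause-factors and flips that create them\<close>

text \<open>If \<open>S\<close> satisfied the residue of \<open>F'\<close>, an assignment containing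
  \<open>\<Inter>F'\<close> and negating \<open>S\<close> elsewhere would lie in \<open>E\<close>,
  hence contain some clause of \<open>F'\<close>; but \<open>S\<close> meets that clause outside
  \<open>\<Inter>F'\<close>. So \<open>F'\<close> is a clause-factor, nontrivial because it is
  proper and has two clauses.\<close>

lemma clause_reducible_if_merge:
  assumes F: "clause_set F" and sub: "F' \<subset> F" and C12: "C1 \<in> F'" "C2 \<in> F'" "C1 \<noteq> C2"
    and E: "\<And>p. total_asg p \<Longrightarrow> E \<subseteq> p \<longleftrightarrow> (\<exists>C\<in>F'. C \<subseteq> p)"
  shows "clause_reducible F"
proof
  assume irr: "clause_irreducible F"
  have F': "clause_set F'" using F sub by (auto simp: clause_set_def intro: finite_subset)
  have EI: "E \<subseteq> \<Inter>F'"
  proof (rule Inter_greatest)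
    fix C assume C: "C \<in> F'"
    then have "consistent C" using F' by (auto simp: clause_set_def is_clause_consistent)
    then show "E \<subseteq> C" by (rule subset_if_total) (use E C in blast)
  qed
  have "unsatisfiable (residue F')"
  proof
    assume "satisfiable (residue F')"
    then obtain S where S: "is_clause S" "\<forall>D\<in>residue F'. S \<inter> D \<noteq> {}"
      unfolding satisfiable_def by blast
    have S2: "S \<inter> (C - \<Inter>F') \<noteq> {}" if "C \<in> F'" for C
    proof -
      have "C - \<Inter>F' \<in> residue F'" using that unfolding residue_def by blast
      then show ?thesis using S(2) by blast
    qed
    let ?T = "\<Inter>F' \<union> {- s |s. s \<in> S \<and> s \<notin> \<Inter>F'}"
    have c: "consistent (\<Inter>F')" using F' C12(1)
      by (meson Inter_lower clause_set_def consistent_subset is_clause_consistent)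
    have sc: "consistent S" using S(1) by (rule is_clause_consistent)
    have "consistent ?T" using consistent_override[OF c sc] .
    then obtain p where p: "total_asg p" "?T \<subseteq> p" by (rule exists_total)
    have "E \<subseteq> p" using EI p(2) by blast
    then obtain C where C: "C \<in> F'" "C \<subseteq> p" using E[OF p(1)] \<open>E \<subseteq> p\<close> by blast
    obtain s where s: "s \<in> S" "s \<in> C" "s \<notin> \<Inter>F'" using S2[OF C(1)] by blast
    then have "- s \<in> p" using p(2) by blast
    then show False using totalD[OF p(1)] s C by auto
  qed
  then have "clause_factor_of F' F"
    using F' sub C12 by (auto simp: clause_factor_of_def clause_factor_def)
  then have "trivial_factor_of F' F" using irr by (auto simp: clause_irreducible_def)
  then have "card F' = 1" using sub by (auto simp: trivial_factor_of_def)
  then show False using C12 by (auto simp: card_1_singleton_iff)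
qed

lemma nfs_reducible_if_clause_reducible: "clause_reducible F \<Longrightarrow> nfs_reducible F"
  unfolding nfs_reducible_def by blast

lemma resolvable_pair_cube:
  assumes "total_asg p" "l \<noteq> 0"
  shows "E \<subseteq> p \<longleftrightarrow> (\<exists>C\<in>{insert l E, insert (- l) E}. C \<subseteq> p)"
  using total_uminus_iff[OF assms] by auto

text \<open>The flip of the first two clauses contains \<open>E \<union> {w, v}\<close>, which forms a clause-factor
  with the third.\<close>

lemma flip_merge:
  assumes F: "uhit F"
    and fresh: "w \<notin> E" "- w \<notin> E" "u \<notin> E" "- u \<notin> E" "v \<notin> E" "- v \<notin> E"
      "\<bar>u\<bar> \<noteq> \<bar>v\<bar>" "\<bar>u\<bar> \<noteq> \<bar>w\<bar>" "\<bar>v\<bar> \<noteq> \<bar>w\<bar>"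
    and 1: "insert u (insert w E) \<in> F"
    and 2: "insert (- u) (insert v (insert w E)) \<in> F"
    and 3: "insert v (insert (- w) E) \<in> F"
  shows "nfs_reducible F"
proof -
  let ?E = "insert w E"
  let ?P = "{?E \<union> {u}, ?E \<union> {- u, v}}" and ?Q = "{?E \<union> {u, - v}, ?E \<union> {v}}"
  let ?G = "(F - ?P) \<union> ?Q"
  have c1: "is_clause (insert u ?E)" and c2: "is_clause (insert (- u) (insert v ?E))"
    and c3: "is_clause (insert v (insert (- w) E))"
    using uhit_clause[OF F] 1 2 3 by auto
  have nz: "u \<noteq> 0" "v \<noteq> 0" "w \<noteq> 0" using c1 c2 by (auto simp: is_clause_def is_literal_def)
  have cE: "is_clause ?E" using c1 by (auto simp: is_clause_def)
  have pf: "nfs_pair_flip ?P ?Q"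
    unfolding nfs_pair_flip_def
    by (rule exI[of _ ?E], rule exI[of _ u], rule exI[of _ v])
      (use cE nz fresh in \<open>auto simp: is_literal_def\<close>)
  have PF: "?P \<subseteq> F" using 1 2 by simp
  \<comment> \<open>Distinct clauses of \<open>F\<close> are incomparable, but one new clause
    contains the first clause of \<open>?P\<close> and the other is contained in the second.\<close>
  have q1: "?E \<union> {u, - v} \<notin> F"
  proof
    assume "?E \<union> {u, - v} \<in> F"
    then have "insert u ?E = ?E \<union> {u, - v}" using uhit_subset_eq[OF F 1] by auto
    then have "- v \<in> insert u ?E" by blast
    then show False using fresh nz by auto
  qed
  have q2: "?E \<union> {v} \<notin> F"
  proof
    assume "?E \<union> {v} \<in> F"
    then have "?E \<union> {v} = insert (- u) (insert v ?E)" using uhit_subset_eq[OF F _ 2] by auto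
    then have "- u \<in> ?E \<union> {v}" by blast
    then show False using fresh nz by auto
  qed
  have step: "nfs_flip_step F ?G"
    unfolding nfs_flip_step_def using pf PF q1 q2 by blast
  let ?F' = "{insert w (insert v E), insert (- w) (insert v E)}"
  have Qc: "is_clause (?E \<union> {u, - v})" "is_clause (?E \<union> {v})"
    using c1 c2 fresh nz by (auto simp: is_clause_def is_literal_def)
  have G: "clause_set ?G"
    using Qc uhit_finite[OF F] uhit_clause[OF F] by (auto simp: clause_set_def)
  have nw: "- w \<notin> insert w E" using fresh nz by auto
  have m1: "insert w (insert v E) \<in> ?G" by (simp add: insert_commute)
  have "insert (- w) (insert v E) \<notin> ?P"
  proof -
    have "- w \<notin> ?E \<union> {u}" "- w \<notin> ?E \<union> {- u, v}" using nw fresh by auto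
    then show ?thesis by blast
  qed
  then have m2: "insert (- w) (insert v E) \<in> ?G" using 3 by (simp add: insert_commute)
  \<comment> \<open>The flipped clause with \<open>- v\<close> lies outside \<open>?F'\<close>,
    which makes \<open>?F'\<close> a proper subset of \<open>?G\<close>.\<close>
  have "- v \<notin> insert w (insert v E)" "- v \<notin> insert (- w) (insert v E)"
    using fresh nz by auto
  then have "?E \<union> {u, - v} \<notin> ?F'" by blast
  moreover have "?E \<union> {u, - v} \<in> ?G" by simp
  ultimately have "?F' \<noteq> ?G" by metis
  then have sub: "?F' \<subset> ?G" by (intro psubsetI insert_subsetI m1 m2 empty_subsetI)
  have ne: "insert w (insert v E) \<noteq> insert (- w) (insert v E)"
  proof -
    have "- w \<notin> insert w (insert v E)" using nw fresh by auto
    then show ?thesis by blast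
  qed
  have "clause_reducible ?G"
    by (rule clause_reducible_if_merge[OF G sub _ _ ne, of "insert v E"])
      (use resolvable_pair_cube[OF _ nz(3)] in auto)
  then show ?thesis using step unfolding nfs_reducible_def by blast
qed

text \<open>The two clauses differ only in the sign of \<open>x\<close>, so together they fill the
  cube \<open>C\<close>; the clause \<open>K\<close> keeps them from being all of
  \<open>F\<close>.\<close>

lemma merge_sides:
  assumes F: "uhit F" and C: "C \<in> proj F x" "C \<in> proj F (- x)"
    and third: "K \<in> F" "K \<noteq> insert x C" "K \<noteq> insert (- x) C"
  shows "nfs_reducible F"
proof (rule nfs_reducible_if_clause_reducible, rule clause_reducible_if_merge)
  show "clause_set F" using F by (simp add: uhit_def)
  show "{insert x C, insert (- x) C} \<subset> F" using C third by (auto simp: proj_def)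
  show "insert x C \<noteq> insert (- x) C"
    using projD[OF F C(1)] by auto
  show "C \<subseteq> p \<longleftrightarrow> (\<exists>K\<in>{insert x C, insert (- x) C}. K \<subseteq> p)" if "total_asg p" for p
    using resolvable_pair_cube[OF that] projD(5)[OF F C(1)] by blast
qed auto

text \<open>Adding \<open>x\<close> back turns a filling of \<open>E\<close> into a filling of
  \<open>insert x E\<close>. Properness holds because the side of \<open>- x\<close> is
  nonempty.\<close>

lemma merge_proj:
  assumes F: "uhit F" and S: "S \<subseteq> proj F x" and C: "C1 \<in> S" "C2 \<in> S" "C1 \<noteq> C2"
    and E: "\<And>p. total_asg p \<Longrightarrow> E \<subseteq> p \<longleftrightarrow> (\<exists>C\<in>S. C \<subseteq> p)"
  shows "nfs_reducible F"
proof (rule nfs_reducible_if_clause_reducible, rule clause_reducible_if_merge)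
  have C1: "C1 \<in> proj F x" using C S by auto
  obtain p where p: "total_asg p" "C1 \<subseteq> p" using exists_total[OF projD(2)[OF F C1]] .
  obtain D where D: "D \<in> proj F (- x)" using proj_swap_imp[OF F p(1) C1 p(2)] by blast
  have "x \<notin> insert (- x) D" using projD[OF F D] by auto
  then have "insert (- x) D \<in> F - insert x ` S" using projD(1)[OF F D] by blast
  moreover have "insert x ` S \<subseteq> F" using S by (auto simp: proj_def)
  ultimately show "insert x ` S \<subset> F" by blast
  show "clause_set F" using F by (simp add: uhit_def)
  show "insert x C1 \<in> insert x ` S" "insert x C2 \<in> insert x ` S" using C by auto
  show "insert x C1 \<noteq> insert x C2"
    using C S projD(3)[OF F] by (meson insert_ident subsetD)
  show "insert x E \<subseteq> p \<longleftrightarrow> (\<exists>C\<in>insert x ` S. C \<subseteq> p)" if "total_asg p" for p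
    using E[OF that] C by auto
qed

text \<open>The side of \<open>- x\<close> fills the single cube \<open>C\<close>: either several
  clauses do so and form a factor, or its only clause equals \<open>C\<close> and merges across
  \<open>x\<close>.\<close>

lemma singular_literal_reducible:
  assumes F: "uhit F" and P: "proj F x = {C}" and card: "card F \<ge> 3"
  shows "nfs_reducible F"
proof -
  have C: "C \<in> proj F x" using P by simp
  have swap: "C \<subseteq> p \<longleftrightarrow> (\<exists>D\<in>proj F (- x). D \<subseteq> p)" if "total_asg p" for p
    using proj_swap[OF F that, of x] P by simp
  show ?thesis
  proof (cases "\<exists>D1\<in>proj F (- x). \<exists>D2\<in>proj F (- x). D1 \<noteq> D2")
    case True
    then show ?thesis using merge_proj[OF F order_refl _ _ _ swap] by blast
  next
    case False
    obtain p where "total_asg p" "C \<subseteq> p" using exists_total[OF projD(2)[OF F C]] .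
    then obtain D where "D \<in> proj F (- x)" using swap by blast
    then have D: "proj F (- x) = {D}" using False by blast
    have D': "D \<in> proj F (- x)" using D by simp
    have "D \<subseteq> C" "C \<subseteq> D"
      using subset_if_total[OF projD(2)[OF F C], of D] subset_if_total[OF projD(2)[OF F D'], of C]
        swap D by auto
    then have CD: "C \<in> proj F (- x)" using D by auto
    have "\<not> F \<subseteq> {insert x C, insert (- x) C}"
    proof
      assume "F \<subseteq> {insert x C, insert (- x) C}"
      then have "card F \<le> card {insert x C, insert (- x) C}" by (intro card_mono) auto
      also have "\<dots> \<le> 2" by (simp add: card_insert_if)
      finally show False using card by simp
    qed
    then show ?thesis using merge_sides[OF F C CD] by blast
  qed
qed

section \<open>Two clashing cubes against at most three\<close>

text \<open>The two cubes on the side of \<open>x\<close> are \<open>A \<union> {y}\<close> and \<open>B \<union> {-y}\<close>. A cube inside their union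
  lies in one of them or in their consensus \<open>A \<union> B\<close>, not mentioning \<open>y\<close>.\<close>

locale crossing =
  fixes F :: "int set set" and x y :: int and A B :: "int set"
  assumes F: "uhit F"
    and sides: "proj F x = {insert y A, insert (- y) B}"
    and y: "y \<notin> A" "- y \<notin> B"
    and classify: "\<And>D. D \<in> proj F (- x) \<Longrightarrow>
      insert y A \<subseteq> D \<or> insert (- y) B \<subseteq> D \<or> (y \<notin> D \<and> - y \<notin> D \<and> A \<union> B \<subseteq> D)"
begin

abbreviation "left \<equiv> {D \<in> proj F (- x). insert y A \<subseteq> D}"
abbreviation "right \<equiv> {D \<in> proj F (- x). insert (- y) B \<subseteq> D}"
abbreviation "cross \<equiv> {D \<in> proj F (- x). y \<notin> D \<and> - y \<notin> D \<and> A \<union> B \<subseteq> D}"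

text \<open>Negating \<open>y\<close> exchanges \<open>left\<close> and \<open>right\<close>, so
  each result below has a mirror image.\<close>

lemma swapped: "crossing F x (- y) B A"
  using F sides y classify by unfold_locales (auto simp: insert_commute)

lemma C1: "insert y A \<in> proj F x" and C2: "insert (- y) B \<in> proj F x"
  using sides by auto

lemma fresh:
  "y \<noteq> 0" "- y \<notin> A" "y \<notin> B" "x \<notin> A" "- x \<notin> A" "x \<notin> B" "- x \<notin> B" "\<bar>x\<bar> \<noteq> \<bar>y\<bar>" "x \<noteq> 0"
  using projD[OF F C1] projD[OF F C2] by (auto simp: consistent_def)

lemma swap: "total_asg p \<Longrightarrow> insert y A \<subseteq> p \<or> insert (- y) B \<subseteq> p \<longleftrightarrow> (\<exists>D\<in>proj F (- x). D \<subseteq> p)"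
  using proj_swap[OF F, of p x] sides by simp

lemma left_or_cross:
  assumes p: "total_asg p" and s: "insert y A \<subseteq> p"
  shows "\<exists>D\<in>left \<union> cross. D \<subseteq> p"
proof -
  obtain D where D: "D \<in> proj F (- x)" "D \<subseteq> p" using swap[OF p] s by blast
  moreover have "\<not> insert (- y) B \<subseteq> D" using D s totalD[OF p, of y] by auto
  ultimately show ?thesis using classify[OF D(1)] by blast
qed

lemma cross_consistent: "D \<in> cross \<Longrightarrow> consistent (insert y D)"
  using projD(2)[OF F] fresh(1) by (auto intro: consistent_insert)

text \<open>The cube \<open>insert y A\<close> is split by \<open>D2\<close> and the half of
  \<open>D1\<close> where \<open>y\<close> holds, so they clash in one literal \<open>b\<close>.
  Flipping these two clauses creates \<open>insert y A\<close> on the side of \<open>- x\<close>,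
  which merges with the same cube on the side of \<open>x\<close>.\<close>

lemma flip_if_single:
  assumes L: "left = {D2}" and X: "cross = {D1}"
  shows "nfs_reducible F"
proof -
  have "D1 \<in> cross" "D2 \<in> left" using L X by simp_all
  then have D1: "D1 \<in> proj F (- x)" "y \<notin> D1" "- y \<notin> D1" "A \<subseteq> D1"
    and D2: "D2 \<in> proj F (- x)" "insert y A \<subseteq> D2" by simp_all
  obtain b where b: "b \<noteq> 0" "b \<notin> insert y A" "- b \<notin> insert y A"
    and 1: "insert y D1 = insert b (insert y A)" and 2: "D2 = insert (- b) (insert y A)"
  proof (rule two_cubes_partition)
    show "consistent (insert y D1)" using cross_consistent X by blast
    show "consistent D2" using projD(2)[OF F D2(1)] .
    show "insert y A \<subseteq> p \<longleftrightarrow> insert y D1 \<subseteq> p \<or> D2 \<subseteq> p" if p: "total_asg p" for p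
      using left_or_cross[OF p] D1 D2 unfolding L X by auto
    show "\<not> (insert y D1 \<subseteq> p \<and> D2 \<subseteq> p)" if p: "total_asg p" for p
      using proj_unique[OF F p D1(1) _ D2(1)] D1 D2 by auto
  qed
  have D1': "D1 = insert b A" using 1 b D1 y by (metis insertI1 insert_commute insert_ident insertE)
  show ?thesis
  proof (rule flip_merge[OF F, where E = A and w = "- x" and u = b and v = y])
    show "insert b (insert (- x) A) \<in> F" "insert (- b) (insert y (insert (- x) A)) \<in> F"
      using projD(1)[OF F D1(1)] projD(1)[OF F D2(1)] D1' 2 by (simp_all add: insert_commute)
    show "insert y (insert (- (- x)) A) \<in> F"
      using projD(1)[OF F C1] by (simp add: insert_commute)
    show "\<bar>b\<bar> \<noteq> \<bar>- x\<bar>" using projD[OF F D1(1)] D1' by auto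
  qed (use fresh y b in \<open>auto simp: abs_eq_iff\<close>)
qed

text \<open>Make \<open>y\<close> false: the cubes in \<open>left\<close> then fail, so one in
  \<open>cross\<close> must hold. It does not mention \<open>y\<close>, so it holds for the original
  value as well.\<close>

lemma cross_covers_right:
  assumes R: "right = {}" and p: "total_asg p" and B: "B \<subseteq> p"
  shows "\<exists>D\<in>cross. D \<subseteq> p"
proof -
  interpret s: crossing F x "- y" B A by (rule swapped)
  have q: "total_asg (set_lit (- y) p)" using total_set_lit[OF p] fresh(1) by simp
  have "insert (- y) B \<subseteq> set_lit (- y) p" using B fresh by (auto simp: set_lit_def)
  then obtain E where E: "E \<in> s.left \<union> s.cross" "E \<subseteq> set_lit (- y) p"
    using s.left_or_cross[OF q] by blast
  have "E \<in> cross" using E(1) R by auto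
  moreover have "E \<subseteq> p" using E(2) \<open>E \<in> cross\<close> by (auto simp: set_lit_def)
  ultimately show ?thesis by blast
qed

text \<open>All clauses in \<open>cross\<close> contain \<open>B\<close> and together they cover its
  cube, so two of them give a factor.\<close>

lemma merge_if_right_empty:
  assumes R: "right = {}" and D: "D \<in> cross" "D' \<in> cross" "D \<noteq> D'"
  shows "nfs_reducible F"
proof (rule merge_proj[OF F, of cross "- x"])
  show "B \<subseteq> p \<longleftrightarrow> (\<exists>D\<in>cross. D \<subseteq> p)" if p: "total_asg p" for p
    using cross_covers_right[OF R p] by auto
qed (use D in auto)

text \<open>Otherwise \<open>cross\<close> alone covers \<open>insert y A\<close>. Its clauses all
  contain a literal \<open>b\<close> of \<open>B\<close> outside \<open>A\<close>, which can be
  falsified within that cube.\<close>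

lemma left_nonempty:
  assumes "\<not> B \<subseteq> A" "cross \<noteq> {}"
  shows "left \<noteq> {}"
proof
  assume L: "left = {}"
  obtain D where D: "D \<in> cross" using assms by blast
  obtain b where b: "b \<in> B" "b \<notin> A" using assms by blast
  have cD: "consistent (insert y D)" using cross_consistent[OF D] .
  then have "consistent (insert y A)" using D by (auto intro: consistent_subset)
  then have "consistent (insert (- b) (insert y A))"
    using b fresh cD D by (intro consistent_insert) (auto simp: consistent_def)
  then obtain p where p: "total_asg p" "insert (- b) (insert y A) \<subseteq> p" by (rule exists_total)
  then obtain E where "E \<in> cross" "E \<subseteq> p" using left_or_cross[OF p(1)] L by auto
  then have "b \<in> p" using b by auto
  then show False using totalD[OF p(1)] p by auto
qed

text \<open>Where \<open>z\<close> fails, only \<open>D3\<close> is left to cover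
  \<open>insert y A\<close>, so \<open>D3\<close> is that half. The half where \<open>z\<close>
  holds is split by \<open>B\<close> and \<open>D2\<close> along one literal \<open>l\<close>.
  Flipping \<open>B\<close> and \<open>D2\<close> restores this half as one clause, which merges
  with \<open>D3\<close> along \<open>z\<close>.\<close>

lemma flip_if_clash_in_cross:
  assumes X: "cross = {B}" and L: "left = {D2, D3}"
    and z: "z \<in> D2" "- z \<in> D3" "z \<in> insert y B"
  shows "nfs_reducible F"
proof -
  let ?E = "insert y A"
  have B: "B \<in> cross" and D2: "D2 \<in> proj F (- x)" "?E \<subseteq> D2" and D3: "D3 \<in> proj F (- x)" "?E \<subseteq> D3"
    using X L by auto
  have BP: "B \<in> proj F (- x)" "A \<subseteq> B" using B by auto
  have c: "consistent D2" "consistent D3" "consistent (insert y B)"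
    using projD(2)[OF F] D2 D3 cross_consistent[OF B] by auto
  have zE: "z \<notin> ?E" "- z \<notin> ?E" "z \<noteq> 0" using z c D2 D3 by (auto simp: consistent_def)
  have cover: "?E \<subseteq> p \<longleftrightarrow> B \<subseteq> p \<and> y \<in> p \<or> D2 \<subseteq> p \<or> D3 \<subseteq> p" if p: "total_asg p" for p
    using left_or_cross[OF p] BP D2 D3 unfolding X L by auto
  have D3': "D3 = insert (- z) ?E"
  proof
    show "insert (- z) ?E \<subseteq> D3" using z D3 by auto
    have "consistent (insert (- z) ?E)" using c(2) z D3 by (auto intro: consistent_subset)
    then show "D3 \<subseteq> insert (- z) ?E"
    proof (rule subset_if_total)
      fix p assume p: "total_asg p" "insert (- z) ?E \<subseteq> p"
      have "z \<notin> p" using p totalD[of p z] by auto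
      then show "D3 \<subseteq> p" using cover[OF p(1)] p z zE by auto
    qed
  qed
  obtain l where l: "l \<noteq> 0" "l \<notin> insert z ?E" "- l \<notin> insert z ?E"
    and 1: "insert y B = insert l (insert z ?E)" and 2: "D2 = insert (- l) (insert z ?E)"
  proof (rule two_cubes_partition)
    show "consistent (insert y B)" "consistent D2" using c by auto
    show "insert z ?E \<subseteq> p \<longleftrightarrow> insert y B \<subseteq> p \<or> D2 \<subseteq> p" if p: "total_asg p" for p
    proof -
      have "z \<in> p \<Longrightarrow> \<not> D3 \<subseteq> p" using z totalD[OF p, of z] by auto
      then show ?thesis using cover[OF p] z D2 BP by auto
    qed
    show "\<not> (insert y B \<subseteq> p \<and> D2 \<subseteq> p)" if p: "total_asg p" for p
      using proj_unique[OF F p BP(1) _ D2(1)] D2 fresh by auto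
  qed
  have "y \<notin> B" using fresh by simp
  moreover have "y \<notin> insert l (insert z A)" using l zE y by auto
  moreover have "insert y B = insert y (insert l (insert z A))" using 1 by (simp add: insert_commute)
  ultimately have B': "B = insert l (insert z A)" by (simp add: insert_ident)
  have lx: "l \<noteq> x" "l \<noteq> - x" "z \<noteq> x" "z \<noteq> - x" "- l \<noteq> x" "- z \<noteq> x"
    using projD[OF F BP(1)] B' by auto
  show ?thesis
  proof (rule flip_merge[OF F, where E = "insert (- x) A" and w = z and u = l and v = y])
    show "insert l (insert z (insert (- x) A)) \<in> F"
      using projD(1)[OF F BP(1)] B' by (simp add: insert_commute)
    show "insert (- l) (insert y (insert z (insert (- x) A))) \<in> F"
      using projD(1)[OF F D2(1)] 2 by (simp add: insert_commute)
    show "insert y (insert (- z) (insert (- x) A)) \<in> F"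
      using projD(1)[OF F D3(1)] D3' by (simp add: insert_commute)
  qed (use fresh y l zE lx in \<open>auto simp: abs_eq_iff\<close>)
qed

text \<open>Since \<open>right\<close> is empty, \<open>D1\<close> equals \<open>B\<close>. Let
  \<open>D2\<close> and \<open>D3\<close> clash in \<open>z\<close>. If \<open>B\<close> mentions
  the variable of \<open>z\<close>, a flip applies; otherwise \<open>D2\<close> and
  \<open>D3\<close> differ only in \<open>z\<close> and merge directly.\<close>

lemma two_left_reducible:
  assumes X: "cross = {D1}" and L: "left = {D2, D3}" "D2 \<noteq> D3" and R: "right = {}"
  shows "nfs_reducible F"
proof -
  let ?E = "insert y A"
  have D1: "D1 \<in> cross" using X by simp
  have cB: "consistent B" using projD(2)[OF F C2] by (auto intro: consistent_subset)
  have "D1 \<subseteq> B"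
  proof (rule subset_if_total[OF cB])
    fix p assume p: "total_asg p" "B \<subseteq> p"
    show "D1 \<subseteq> p" using cross_covers_right[OF R p] unfolding X by simp
  qed
  then have "D1 = B" using D1 by auto
  then have X: "cross = {B}" using X by simp
  have B: "B \<in> cross" using X by simp
  have BP: "B \<in> proj F (- x)" "A \<subseteq> B" using B by auto
  have D2: "D2 \<in> proj F (- x)" "?E \<subseteq> D2" and D3: "D3 \<in> proj F (- x)" "?E \<subseteq> D3" using L by auto
  have c: "consistent D2" "consistent D3" using projD(2)[OF F] D2 D3 by auto
  obtain z where z: "z \<in> D2" "- z \<in> D3"
    using exists_clash[OF c] proj_unique[OF F _ D2(1) _ D3(1)] L(2) by blast
  have zE: "z \<notin> ?E" "- z \<notin> ?E" "z \<noteq> 0" using z c D2 D3 by (auto simp: consistent_def)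
  consider "z \<in> insert y B" | "- z \<in> insert y B" | "z \<notin> insert y B" "- z \<notin> insert y B" by blast
  then show ?thesis
  proof cases
    case 1
    then show ?thesis using flip_if_clash_in_cross[OF X L(1)] z by blast
  next
    case 2
    have "left = {D3, D2}" using L by auto
    then show ?thesis using flip_if_clash_in_cross[OF X, of D3 D2 "- z"] z 2 by simp
  next
    case 3
    \<comment> \<open>Start in \<open>U\<close> with \<open>u\<close> false. There \<open>B\<close>
      fails by disjointness, and it still fails once \<open>u\<close> is made true because it does
      not mention \<open>u\<close>. As \<open>U\<close> now fails too, \<open>V\<close> must
      hold.\<close>
    have aux: "V - {u} \<subseteq> U - {- u}"
      if UV: "left = {U, V}" "U \<noteq> V" and u: "u \<in> V" "- u \<in> U" "u \<notin> ?E" "- u \<notin> ?E" "u \<noteq> 0"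
        "u \<notin> B" "- u \<notin> B" for U V u
    proof (rule subset_if_total)
      have U: "U \<in> proj F (- x)" "?E \<subseteq> U" and V: "V \<in> proj F (- x)" using UV by auto
      show "consistent (U - {- u})" using projD(2)[OF F U(1)] by (auto intro: consistent_subset)
      fix p assume p: "total_asg p" "U - {- u} \<subseteq> p"
      have U0: "u \<notin> U" using projD(2)[OF F U(1)] u by (auto simp: consistent_def)
      have q: "total_asg (set_lit u p)" and r: "total_asg (set_lit (- u) p)"
        using total_set_lit[OF p(1)] u by auto
      have rU: "U \<subseteq> set_lit (- u) p" using p U0 by (auto simp: set_lit_def)
      have "\<not> B \<subseteq> set_lit (- u) p"
        using proj_unique[OF F r BP(1) _ U(1) rU] U fresh(3) by auto
      then have nB: "\<not> B \<subseteq> set_lit u p" using u by (auto simp: set_lit_def)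
      have "- u \<notin> set_lit u p" using not_in_set_lit u by blast
      then have nU: "\<not> U \<subseteq> set_lit u p" using u by auto
      have "?E \<subseteq> set_lit u p" using U u p by (auto simp: set_lit_def)
      then have "V \<subseteq> set_lit u p" using left_or_cross[OF q] nB nU unfolding X UV(1) by auto
      then show "V - {u} \<subseteq> p" by (auto simp: set_lit_def)
    qed
    have "left = {D3, D2}" using L by auto
    then have "D2 - {z} \<subseteq> D3 - {- z}" "D3 - {- z} \<subseteq> D2 - {z}"
      using aux[of D3 D2 z] aux[of D2 D3 "- z"] L z zE 3 by auto
    then have eq: "D3 = insert (- z) (D2 - {z})" using z by auto
    show ?thesis
    proof (rule merge_proj[OF F, of "{D2, D3}" "- x"])
      show "D2 - {z} \<subseteq> p \<longleftrightarrow> (\<exists>C\<in>{D2, D3}. C \<subseteq> p)" if "total_asg p" for p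
        using resolvable_pair_cube[OF that zE(3), of "D2 - {z}"] eq z by (simp add: insert_absorb)
    qed (use D2 D3 L in auto)
  qed
qed

lemma reducible:
  assumes X: "cross \<noteq> {}" and card: "card (proj F (- x)) \<le> 3"
  shows "nfs_reducible F"
proof -
  interpret s: crossing F x "- y" B A by (rule swapped)
  have sX: "s.cross = cross" and sR: "s.right = left" by auto
  have fin: "finite left" "finite right" "finite cross" using finite_proj[OF F, of "- x"] by auto
  have dLR: "left \<inter> right = {}" using projD(2)[OF F] by (auto simp: consistent_def)
  have "card (left \<union> right \<union> cross) = card (left \<union> right) + card cross"
    using fin by (intro card_Un_disjoint) auto
  also have "card (left \<union> right) = card left + card right"
    using fin dLR by (intro card_Un_disjoint) auto
  finally have "card (left \<union> right \<union> cross) = card left + card right + card cross" .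
  moreover have "left \<union> right \<union> cross = proj F (- x)" using classify by blast
  ultimately have sum: "card left + card right + card cross \<le> 3" using card by simp
  have cX: "card cross \<ge> 1" using X fin by (simp add: Suc_le_eq card_gt_0_iff)
  \<comment> \<open>Here \<open>a\<close>, \<open>b\<close>, \<open>c\<close> stand for the sizes of
    \<open>left\<close>, \<open>right\<close> and \<open>cross\<close>; the disjuncts come in pairs
    of mirror images.\<close>
  have *: "a = 1 \<and> c = 1 \<or> b = 1 \<and> c = 1 \<or> b = 0 \<and> c = 2 \<or> a = 0 \<and> c = 2 \<or>
      a = 2 \<and> b = 0 \<and> c = 1 \<or> b = 2 \<and> a = 0 \<and> c = 1"
    if "a \<ge> 1 \<or> b \<ge> 1" "a + b + c \<le> 3" "c \<ge> 1" for a b c :: nat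
    using that by presburger
  show ?thesis
  proof (cases "left = {} \<and> right = {}")
    case True
    \<comment> \<open>\<open>left_nonempty\<close> in both orientations gives the two inclusions;
      the clauses on the side of \<open>x\<close> then merge along \<open>y\<close>.\<close>
    then have "A = B" using left_nonempty s.left_nonempty X sX by auto
    show ?thesis
    proof (rule merge_proj[OF F order_refl C1 C2])
      show "insert y A \<noteq> insert (- y) B" using fresh by auto
      show "A \<subseteq> p \<longleftrightarrow> (\<exists>C\<in>proj F x. C \<subseteq> p)" if "total_asg p" for p
        using resolvable_pair_cube[OF that fresh(1), of A] sides \<open>A = B\<close> by simp
    qed
  next
    case False
    then have "card left \<ge> 1 \<or> card right \<ge> 1" using fin by (simp add: Suc_le_eq card_gt_0_iff)
    from *[OF this sum cX] show ?thesis
    proof (elim disjE conjE, goal_cases)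
      case 1
      then show ?thesis using flip_if_single by (meson card_1_singletonE)
    next
      case 2
      then show ?thesis using s.flip_if_single unfolding sX by (meson card_1_singletonE)
    next
      case 3
      then obtain D D' where "cross = {D, D'}" "D \<noteq> D'" by (meson card_2_iff)
      moreover have "right = {}" using 3 fin by simp
      ultimately show ?thesis using merge_if_right_empty[of D D'] by blast
    next
      case 4
      then obtain D D' where "s.cross = {D, D'}" "D \<noteq> D'" unfolding sX by (meson card_2_iff)
      moreover have "s.right = {}" using 4 fin unfolding sR by simp
      ultimately show ?thesis using s.merge_if_right_empty[of D D'] by blast
    next
      case 5
      then obtain D1 D2 D3 where "cross = {D1}" "left = {D2, D3}" "D2 \<noteq> D3"
        by (meson card_2_iff card_1_singletonE)
      moreover have "right = {}" using 5 fin by simp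
      ultimately show ?thesis by (rule two_left_reducible)
    next
      case 6
      then obtain D1 D2 D3 where "s.cross = {D1}" "s.left = {D2, D3}" "D2 \<noteq> D3"
        unfolding sX by (meson card_2_iff card_1_singletonE)
      moreover have "s.right = {}" using 6 fin unfolding sR by simp
      ultimately show ?thesis by (rule s.two_left_reducible)
    qed
  qed
qed

end

section \<open>Literals occurring twice\<close>

text \<open>Without crossing cubes, only \<open>D\<close> can cover the cube of \<open>C1\<close>,
  so \<open>D\<close> equals \<open>C1\<close> and the clause-factor arises across \<open>x\<close>;
  the clause from \<open>C2\<close> makes it proper.\<close>

lemma uncrossed_single_reducible:
  assumes F: "uhit F" and P: "proj F x = {C1, C2}" "C1 \<noteq> C2"
    and L: "{D \<in> proj F (- x). C1 \<subseteq> D} = {D}"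
    and uncrossed: "\<And>D. D \<in> proj F (- x) \<Longrightarrow> C1 \<subseteq> D \<or> C2 \<subseteq> D"
  shows "nfs_reducible F"
proof -
  have C1: "C1 \<in> proj F x" and C2: "C2 \<in> proj F x" using P by auto
  have D: "D \<in> proj F (- x)" "C1 \<subseteq> D" using L by auto
  have "D \<subseteq> C1"
  proof (rule subset_if_total[OF projD(2)[OF F C1]])
    fix p assume p: "total_asg p" "C1 \<subseteq> p"
    obtain E where E: "E \<in> proj F (- x)" "E \<subseteq> p" using proj_swap_imp[OF F p(1) C1 p(2)] by blast
    have "\<not> C2 \<subseteq> p" using proj_unique[OF F p(1) C1 p(2) C2] P by auto
    then have "C1 \<subseteq> E" using uncrossed[OF E(1)] E by auto
    then show "D \<subseteq> p" using E L by blast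
  qed
  then have "C1 \<in> proj F (- x)" using D by auto
  moreover have "insert x C2 \<noteq> insert x C1"
    using P projD(3)[OF F C1] projD(3)[OF F C2] by (metis insert_ident)
  moreover have "insert x C2 \<noteq> insert (- x) C1" using projD(3)[OF F C1] projD(5)[OF F C1] by (metis equal_neg_zero insertE insertI1)
  ultimately show ?thesis using merge_sides[OF F C1] projD(1)[OF F C2] by blast
qed

text \<open>If some opposite cube lies in neither \<open>C1\<close> nor \<open>C2\<close>, the
  crossing analysis applies. Otherwise the opposite cubes are divided between the two, and one of
  them receives exactly one.\<close>

lemma degree_two_literal_reducible:
  assumes F: "uhit F" and P: "proj F x = {C1, C2}" "C1 \<noteq> C2" and card: "card (proj F (- x)) \<le> 3"
  shows "nfs_reducible F"
proof -
  let ?H = "proj F (- x)"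
  have C1: "C1 \<in> proj F x" and C2: "C2 \<in> proj F x" using P by auto
  have disj: "\<not> (C1 \<subseteq> p \<and> C2 \<subseteq> p)" if "total_asg p" for p
    using proj_unique[OF F that C1 _ C2] P by auto
  have swap: "C1 \<subseteq> p \<or> C2 \<subseteq> p \<longleftrightarrow> (\<exists>D\<in>?H. D \<subseteq> p)" if "total_asg p" for p
    using proj_swap[OF F that, of x] P by simp
  have cross: thesis if D: "D \<in> ?H" "\<not> C1 \<subseteq> D" "\<not> C2 \<subseteq> D"
    and *: "\<And>y. \<lbrakk>y \<in> C1; - y \<in> C2; C1 - {y} \<subseteq> D; C2 - {- y} \<subseteq> D; y \<notin> D; - y \<notin> D\<rbrakk> \<Longrightarrow> thesis"
  for D thesis
    using cube_in_two_cubes[OF projD(2)[OF F D(1)] _ D(2,3)] swap D(1) * by metis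
  show ?thesis
  proof (cases "\<exists>D\<in>?H. \<not> C1 \<subseteq> D \<and> \<not> C2 \<subseteq> D")
    case True
    then obtain D where D: "D \<in> ?H" "\<not> C1 \<subseteq> D" "\<not> C2 \<subseteq> D" by blast
    obtain y where clash: "y \<in> C1" "- y \<in> C2" "C1 - {y} \<subseteq> D" "C2 - {- y} \<subseteq> D" "y \<notin> D" "- y \<notin> D"
      using cross[OF D] .
    have i: "insert y (C1 - {y}) = C1" "insert (- y) (C2 - {- y}) = C2" using clash by auto
    interpret crossing F x y "C1 - {y}" "C2 - {- y}"
    proof unfold_locales
      show "proj F x = {insert y (C1 - {y}), insert (- y) (C2 - {- y})}" using P i by simp
      fix E assume E: "E \<in> ?H"
      show "insert y (C1 - {y}) \<subseteq> E \<or> insert (- y) (C2 - {- y}) \<subseteq> E \<or>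
        (y \<notin> E \<and> - y \<notin> E \<and> (C1 - {y}) \<union> (C2 - {- y}) \<subseteq> E)"
      proof (rule ccontr)
        assume n: "\<not> ?thesis"
        then have nE: "\<not> C1 \<subseteq> E" "\<not> C2 \<subseteq> E" using i by auto
        obtain z where z: "z \<in> C1" "- z \<in> C2" "C1 - {z} \<subseteq> E" "C2 - {- z} \<subseteq> E" "z \<notin> E" "- z \<notin> E"
          using cross[OF E nE] .
        \<comment> \<open>All crossing cubes use the same literal: a second clash \<open>z\<close>
          would put both \<open>z\<close> and \<open>- z\<close> into \<open>D\<close>.\<close>
        have "z = y"
        proof (rule ccontr)
          assume "z \<noteq> y"
          then have "z \<in> D" "- z \<in> D" using z clash by auto
          then show False using projD(2)[OF F D(1)] by (auto simp: consistent_def)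
        qed
        then show False using n z by auto
      qed
    qed (use F in auto)
    have "D \<in> cross" using D clash by blast
    then show ?thesis using reducible card by blast
  next
    case False
    let ?L = "{D \<in> ?H. C1 \<subseteq> D}" and ?R = "{D \<in> ?H. C2 \<subseteq> D}"
    have fin: "finite ?L" "finite ?R" using finite_proj[OF F, of "- x"] by auto
    have "?L \<inter> ?R = {}"
      using projD(2)[OF F] disj exists_total by (smt (verit) disjoint_iff mem_Collect_eq order_trans)
    then have "card (?L \<union> ?R) = card ?L + card ?R" using fin by (intro card_Un_disjoint)
    moreover have "?L \<union> ?R = ?H" using False by blast
    ultimately have sum: "card ?L + card ?R \<le> 3" using card by simp
    have ne: "{D \<in> ?H. C \<subseteq> D} \<noteq> {}" if C: "C \<in> proj F x" "proj F x = {C, C'}" "C \<noteq> C'" for C C'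
    proof -
      obtain p where p: "total_asg p" "C \<subseteq> p" using exists_total[OF projD(2)[OF F C(1)]] .
      obtain E where E: "E \<in> ?H" "E \<subseteq> p" using proj_swap_imp[OF F p(1) C(1) p(2)] by blast
      have "\<not> C' \<subseteq> p" using proj_unique[OF F p(1) C(1) p(2), of C'] C by auto
      then have "\<not> C' \<subseteq> E" using E by auto
      then have "C \<subseteq> E" using False E C P by (metis doubleton_eq_iff)
      then show ?thesis using E by blast
    qed
    have P': "proj F x = {C2, C1}" "C2 \<noteq> C1" using P by auto
    have "card ?L \<ge> 1" "card ?R \<ge> 1"
      using ne[OF C1 P] ne[OF C2 P'] fin by (simp_all add: Suc_le_eq card_gt_0_iff)
    then have "card ?L = 1 \<or> card ?R = 1" using sum by linarith
    then show ?thesis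
      using uncrossed_single_reducible[OF F P] uncrossed_single_reducible[OF F P'] False
      by (metis (no_types, lifting) card_1_singletonE)
  qed
qed

section \<open>Restriction at a variable of minimal degree\<close>

definition occ :: "int set set \<Rightarrow> int \<Rightarrow> int set set" where
  "occ F x = {C \<in> F. x \<in> C}"

definition var_occ :: "int set set \<Rightarrow> int \<Rightarrow> int set set" where
  "var_occ F v = occ F v \<union> occ F (- v)"

text \<open>In terms of cubes this is the trace of the partition on the face where
  \<open>- x\<close> holds: clauses with \<open>x\<close> miss that face, and \<open>- x\<close> is
  constant on it.\<close>

definition restrict_lit :: "int set set \<Rightarrow> int \<Rightarrow> int set set" where
  "restrict_lit F x = (\<lambda>C. C - {- x}) ` (F - occ F x)"

definition min_var :: "int set set \<Rightarrow> int \<Rightarrow> bool" where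
  "min_var F v \<longleftrightarrow> v \<in> vars F \<and> (\<forall>w\<in>vars F. card (var_occ F v) \<le> card (var_occ F w))"

lemma vars_iff:
  assumes F: "uhit F"
  shows "v \<in> vars F \<longleftrightarrow> v > 0 \<and> var_occ F v \<noteq> {}"
proof -
  have nz: "0 \<notin> C" if "C \<in> F" for C
    using uhit_clause[OF F that] by (auto simp: is_clause_def is_literal_def)
  show ?thesis
  proof
    assume "v \<in> vars F"
    then obtain C z where "C \<in> F" "z \<in> C" "v = \<bar>z\<bar>" by (auto simp: vars_def)
    then show "v > 0 \<and> var_occ F v \<noteq> {}"
      using nz[of C] by (cases "z > 0") (auto simp: var_occ_def occ_def abs_if)
  next
    assume v: "v > 0 \<and> var_occ F v \<noteq> {}"
    then obtain C where "C \<in> F" "v \<in> C \<or> - v \<in> C" by (auto simp: var_occ_def occ_def)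
    then show "v \<in> vars F" using v unfolding vars_def
      by (metis UnionI abs_minus_cancel abs_of_pos image_eqI)
  qed
qed

lemma finite_vars: "uhit F \<Longrightarrow> finite (vars F)"
  by (auto simp: vars_def uhit_def clause_set_def is_clause_def)

lemma finite_occ: "uhit F \<Longrightarrow> finite (occ F x)"
  by (simp add: occ_def uhit_finite)

lemma ex_min_var:
  assumes "uhit F" "vars F \<noteq> {}"
  obtains v where "min_var F v"
proof -
  have "arg_min_on (\<lambda>v. card (var_occ F v)) (vars F) \<in> vars F"
    using arg_min_if_finite(1)[OF finite_vars[OF assms(1)] assms(2)] .
  then have "min_var F (arg_min_on (\<lambda>v. card (var_occ F v)) (vars F))"
    unfolding min_var_def
    by (intro conjI ballI arg_min_least[OF finite_vars[OF assms(1)] assms(2)])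
  then show thesis by (rule that)
qed

lemma card_var_occ:
  assumes "uhit F"
  shows "card (var_occ F v) = card (occ F v) + card (occ F (- v))"
  unfolding var_occ_def
proof (rule card_Un_disjoint)
  show "occ F v \<inter> occ F (- v) = {}"
    using uhit_clause[OF assms] by (auto simp: occ_def is_clause_def)
qed (auto simp: finite_occ assms)

lemma occ_uminus_nonempty:
  assumes F: "uhit F" and "occ F x \<noteq> {}"
  shows "occ F (- x) \<noteq> {}"
proof -
  obtain K where "K \<in> F" "x \<in> K" using assms(2) by (auto simp: occ_def)
  then have C: "K - {x} \<in> proj F x" (is "?C \<in> _") by (simp add: proj_def insert_absorb)
  obtain p where p: "total_asg p" "?C \<subseteq> p" using exists_total[OF projD(2)[OF F C]] .
  obtain D where "D \<in> proj F (- x)" using proj_swap_imp[OF F p(1) C p(2)] by blast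
  then show ?thesis by (auto simp: occ_def proj_def)
qed

lemma occ_nonempty:
  assumes F: "uhit F" and v: "v \<in> vars F" and x: "\<bar>x\<bar> = v"
  shows "card (occ F x) \<ge> 1"
proof -
  have "occ F v \<noteq> {} \<or> occ F (- v) \<noteq> {}" using v vars_iff[OF F] by (auto simp: var_occ_def)
  then have "occ F v \<noteq> {} \<and> occ F (- v) \<noteq> {}"
    using occ_uminus_nonempty[OF F, of v] occ_uminus_nonempty[OF F, of "- v"]
    by (metis add.inverse_inverse)
  moreover have "x = v \<or> x = - v" using x by auto
  ultimately have "occ F x \<noteq> {}" by auto
  then show ?thesis using finite_occ[OF F] by (simp add: Suc_le_eq card_gt_0_iff)
qed

lemma restrict_cube:
  assumes "x \<noteq> 0" "x \<notin> C"
  shows "C - {- x} \<subseteq> p \<longleftrightarrow> C \<subseteq> set_lit (- x) p"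
  using assms by (auto simp: set_lit_def)

lemma uhit_restrict:
  assumes F: "uhit F" and x: "x \<noteq> 0"
  shows "uhit (restrict_lit F x)"
  unfolding uhit_def
proof (intro conjI allI impI)
  show "clause_set (restrict_lit F x)"
    using uhit_finite[OF F] uhit_clause[OF F]
    by (auto simp: clause_set_def restrict_lit_def is_clause_def)
  fix p assume "total_asg p"
  then have q: "total_asg (set_lit (- x) p)" using x total_set_lit by simp
  have x': "x \<notin> set_lit (- x) p" using not_in_set_lit[of "- x"] x by simp
  obtain C where C: "C \<in> F" "C \<subseteq> set_lit (- x) p" using uhit_ex[OF F q] by blast
  have xC: "x \<notin> C" using C x' by auto
  show "\<exists>!C. C \<in> restrict_lit F x \<and> C \<subseteq> p"
  proof (intro ex1I conjI)
    show "C - {- x} \<in> restrict_lit F x" using C xC by (auto simp: restrict_lit_def occ_def)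
    show "C - {- x} \<subseteq> p" using restrict_cube[OF x xC] C by simp
    fix D' assume "D' \<in> restrict_lit F x \<and> D' \<subseteq> p"
    then obtain D where D: "D \<in> F" "x \<notin> D" "D' = D - {- x}" "D - {- x} \<subseteq> p"
      by (auto simp: restrict_lit_def occ_def)
    then show "D' = C - {- x}"
      using uhit_unique[OF F q C(1) D(1) C(2)] restrict_cube[OF x D(2)] by auto
  qed
qed

text \<open>Clauses with equal restrictions lie in a common assignment containing
  \<open>- x\<close>, so uniqueness identifies them.\<close>

lemma inj_restrict:
  assumes F: "uhit F" and x: "x \<noteq> 0"
  shows "inj_on (\<lambda>C. C - {- x}) (F - occ F x)"
proof (rule inj_onI)
  fix C D assume CD: "C \<in> F - occ F x" "D \<in> F - occ F x" and eq: "C - {- x} = D - {- x}"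
  have "consistent (C - {- x})"
    using CD uhit_clause[OF F] is_clause_consistent consistent_subset by (meson DiffD1 Diff_subset)
  then obtain p where p: "total_asg p" "C - {- x} \<subseteq> p" by (rule exists_total)
  have n: "x \<notin> C" "x \<notin> D" using CD by (auto simp: occ_def)
  show "C = D"
    using uhit_unique[OF F total_set_lit[OF p(1)], of "- x" C D] restrict_cube[OF x n(1), of p]
      restrict_cube[OF x n(2), of p] CD p eq x by simp
qed

lemma card_restrict:
  assumes F: "uhit F" and x: "x \<noteq> 0"
  shows "card (restrict_lit F x) + card (occ F x) = card F"
proof -
  have "card (restrict_lit F x) = card (F - occ F x)"
    unfolding restrict_lit_def by (rule card_image[OF inj_restrict[OF F x]])
  moreover have "occ F x \<subseteq> F" by (auto simp: occ_def)
  ultimately show ?thesis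
    using uhit_finite[OF F] by (metis card_mono card_Diff_subset finite_subset le_add_diff_inverse2)
qed

text \<open>A variable lost by the restriction would occur only in clauses containing \<open>x\<close>,
  hence less often than \<open>\<bar>x\<bar>\<close>.\<close>

lemma vars_restrict:
  assumes F: "uhit F" and m: "min_var F \<bar>x\<bar>"
  shows "vars (restrict_lit F x) = vars F - {\<bar>x\<bar>}"
proof
  have x: "x \<noteq> 0" using m vars_iff[OF F] by (auto simp: min_var_def)
  have "z \<noteq> x \<and> z \<noteq> - x" if "C \<in> F" "x \<notin> C" "z \<in> C - {- x}" for C z using that by auto
  then show "vars (restrict_lit F x) \<subseteq> vars F - {\<bar>x\<bar>}"
    by (fastforce simp: vars_def restrict_lit_def occ_def abs_eq_iff)
  show "vars F - {\<bar>x\<bar>} \<subseteq> vars (restrict_lit F x)"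
  proof
    fix w assume w: "w \<in> vars F - {\<bar>x\<bar>}"
    have ox: "occ F \<bar>x\<bar> \<union> occ F (- \<bar>x\<bar>) = occ F x \<union> occ F (- x)" by (auto simp: abs_if)
    have "\<not> var_occ F w \<subseteq> occ F x"
    proof
      assume "var_occ F w \<subseteq> occ F x"
      then have "card (var_occ F w) \<le> card (occ F x)" by (rule card_mono[OF finite_occ[OF F]])
      moreover have "card (var_occ F \<bar>x\<bar>) = card (occ F x) + card (occ F (- x))"
        using card_var_occ[OF F, of x] ox by (simp add: var_occ_def)
      moreover have "card (occ F (- x)) \<ge> 1"
        using occ_nonempty[OF F, of "\<bar>x\<bar>" "- x"] m by (simp add: min_var_def)
      ultimately show False using m w by (auto simp: min_var_def)
    qed
    then obtain C where C: "C \<in> F" "x \<notin> C" "w \<in> C \<or> - w \<in> C" by (auto simp: var_occ_def occ_def)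
    have "w > 0" using w vars_iff[OF F] by blast
    then have "w \<noteq> x" "w \<noteq> - x" using w by auto
    then have "w \<in> C - {- x} \<or> - w \<in> C - {- x}" using C by auto
    moreover have "C - {- x} \<in> restrict_lit F x" using C by (auto simp: restrict_lit_def occ_def)
    ultimately have "var_occ (restrict_lit F x) w \<noteq> {}" by (auto simp: var_occ_def occ_def)
    then show "w \<in> vars (restrict_lit F x)"
      using vars_iff[OF uhit_restrict[OF F x]] \<open>w > 0\<close> by blast
  qed
qed

lemma card_vars_restrict:
  assumes F: "uhit F" and m: "min_var F \<bar>x\<bar>"
  shows "card (vars F) = Suc (card (vars (restrict_lit F x)))"
  using m finite_vars[OF F] unfolding vars_restrict[OF F m] min_var_def
  by (metis card_Suc_Diff1)

text \<open>Deficiency is always positive: restricting at a variable of minimal degree removes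
  exactly one variable and at least one clause, so the strict inequality carries over from the
  smaller clause-set.\<close>

lemma card_vars_less_card:
  assumes "uhit F"
  shows "card (vars F) < card F"
  using assms
proof (induction "card (vars F)" arbitrary: F)
  case 0
  obtain p where "total_asg p" using exists_total[of "{}"] by (auto simp: consistent_def)
  then have "F \<noteq> {}" using uhit_ex[OF 0(2)] by blast
  then show ?case using 0 uhit_finite by (metis card_gt_0_iff)
next
  case (Suc n)
  then have "vars F \<noteq> {}" by auto
  then obtain v where v: "min_var F v" using ex_min_var[OF Suc.prems] by blast
  then have v': "v > 0" using vars_iff[OF Suc.prems] by (auto simp: min_var_def)
  then have m: "min_var F \<bar>v\<bar>" using v by simp
  have "card (vars (restrict_lit F v)) < card (restrict_lit F v)"
    by (rule Suc.hyps(1))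
      (use card_vars_restrict[OF Suc.prems m] Suc.hyps uhit_restrict[OF Suc.prems] v' in auto)
  moreover have "card (occ F v) \<ge> 1"
    using occ_nonempty[OF Suc.prems, of v v] v v' by (simp add: min_var_def)
  ultimately show ?case
    using card_vars_restrict[OF Suc.prems m] card_restrict[OF Suc.prems, of v] v' by linarith
qed

text \<open>The restriction has lost one variable and all clauses with \<open>x\<close>, and still
  has positive deficiency. So \<open>x\<close> occurs at most as often as the deficiency of
  \<open>F\<close>.\<close>

lemma min_var_occ_le:
  assumes F: "uhit F" and m: "min_var F \<bar>x\<bar>"
  shows "card (vars F) + card (occ F x) \<le> card F"
proof -
  have x: "x \<noteq> 0" using m vars_iff[OF F] by (auto simp: min_var_def)
  show ?thesis
    using card_vars_less_card[OF uhit_restrict[OF F x]] card_vars_restrict[OF F m] card_restrict[OF F x]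
    by linarith
qed

text \<open>Each clause mentioning \<open>w\<close> either contains \<open>x\<close> or survives
  injectively, still mentioning \<open>w\<close>.\<close>

lemma card_var_occ_le_restrict:
  assumes F: "uhit F" and x: "x \<noteq> 0" and w: "w \<noteq> x" "w \<noteq> - x"
  shows "card (var_occ F w) \<le> card (occ F x) + card (var_occ (restrict_lit F x) w)"
proof -
  let ?f = "\<lambda>C. C - {- x}"
  have fin: "finite (var_occ (restrict_lit F x) w)"
    unfolding var_occ_def using finite_occ[OF uhit_restrict[OF F x]] by simp
  have "?f ` (var_occ F w - occ F x) \<subseteq> var_occ (restrict_lit F x) w"
    using w by (auto simp: var_occ_def occ_def restrict_lit_def)
  moreover have "inj_on ?f (var_occ F w - occ F x)"
    by (rule inj_on_subset[OF inj_restrict[OF F x]]) (auto simp: var_occ_def occ_def)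
  ultimately have "card (var_occ F w - occ F x) \<le> card (var_occ (restrict_lit F x) w)"
    using card_inj_on_le fin by blast
  moreover have "card (var_occ F w) \<le> card (occ F x \<union> (var_occ F w - occ F x))"
    by (rule card_mono) (auto simp: var_occ_def finite_occ[OF F])
  moreover have "\<dots> \<le> card (occ F x) + card (var_occ F w - occ F x)" by (rule card_Un_le)
  ultimately show ?thesis by linarith
qed

lemma min_var_degree_le_5:
  assumes F: "uhit F" and d: "card F = card (vars F) + 3" and m: "min_var F v"
  shows "card (var_occ F v) \<le> 5"
proof (rule ccontr)
  assume n: "\<not> ?thesis"
  have v: "v > 0" using m vars_iff[OF F] by (auto simp: min_var_def)
  have m': "min_var F \<bar>v\<bar>" "min_var F \<bar>- v\<bar>" using m v by auto
  have "card (occ F v) \<le> 3" "card (occ F (- v)) \<le> 3"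
    using min_var_occ_le[OF F m'(1)] min_var_occ_le[OF F m'(2)] d by auto
  then have o3: "card (occ F v) = 3" using n card_var_occ[OF F, of v] by linarith
  let ?R = "restrict_lit F v"
  have R: "uhit ?R" using uhit_restrict[OF F] v by simp
  \<comment> \<open>Three clauses and one variable disappear, so the deficiency drops from 3 to
    1.\<close>
  have cR: "card ?R = card (vars ?R) + 1"
    using card_restrict[OF F, of v] card_vars_restrict[OF F m'(1)] o3 d v by linarith
  have "vars ?R \<noteq> {}"
  proof
    assume "vars ?R = {}"
    then have e: "vars F \<subseteq> {v}" using vars_restrict[OF F m'(1)] v by auto
    \<comment> \<open>With \<open>v\<close> as the only variable, at most one clause could contain
      \<open>v\<close>, against three occurrences.\<close>
    have "occ F v \<subseteq> {{v}}"
    proof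
      fix C assume "C \<in> occ F v"
      then have C: "C \<in> F" "v \<in> C" by (auto simp: occ_def)
      have "z = v" if z: "z \<in> C" for z
      proof -
        have "\<bar>z\<bar> \<in> vars F" using C z by (auto simp: vars_def)
        then have "\<bar>z\<bar> = v" using e by auto
        moreover have "z \<noteq> - v" using uhit_clause[OF F C(1)] C z by (auto simp: is_clause_def)
        ultimately show ?thesis by auto
      qed
      then have "C = {v}" using C(2) by blast
      then show "C \<in> {{v}}" by simp
    qed
    then have "card (occ F v) \<le> card {{v}}" by (intro card_mono) auto
    then show False using o3 by simp
  qed
  then obtain w where w: "min_var ?R w" using ex_min_var[OF R] by blast
  have w0: "w > 0" "w \<in> vars ?R" using w vars_iff[OF R] by (auto simp: min_var_def)
  then have wF: "w \<in> vars F" "w \<noteq> v" "w \<noteq> - v" using vars_restrict[OF F m'(1)] v by auto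
  \<comment> \<open>Deficiency 1 allows each literal of \<open>w\<close> one occurrence in
    \<open>?R\<close>; at most three clauses containing \<open>v\<close> come on top in
    \<open>F\<close>.\<close>
  have "card (occ ?R w) \<le> 1" "card (occ ?R (- w)) \<le> 1"
    using min_var_occ_le[OF R, of w] min_var_occ_le[OF R, of "- w"] w w0 cR by auto
  then have "card (var_occ ?R w) \<le> 2" using card_var_occ[OF R, of w] by linarith
  then have "card (var_occ F w) \<le> 5"
    using card_var_occ_le_restrict[OF F _ wF(2,3)] v o3 by linarith
  moreover have "card (var_occ F v) \<le> card (var_occ F w)" using m wF by (auto simp: min_var_def)
  ultimately show False using n by linarith
qed

section \<open>Reduction in deficiency three\<close>

lemma low_degree_literal_reducible:
  assumes F: "uhit F" "card F \<ge> 3"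
    and "card (occ F x) \<in> {1, 2}" "card (occ F (- x)) \<le> 3"
  shows "nfs_reducible F"
proof -
  have c: "card (proj F x) = card (occ F x)" "card (proj F (- x)) = card (occ F (- x))"
    using card_proj[OF F(1)] by (auto simp: occ_def)
  from assms(3) consider "card (proj F x) = 1" | "card (proj F x) = 2" using c by auto
  then show ?thesis
  proof cases
    case 1
    then show ?thesis using singular_literal_reducible[OF F(1) _ F(2)] by (meson card_1_singletonE)
  next
    case 2
    then obtain C1 C2 where "proj F x = {C1, C2}" "C1 \<noteq> C2" by (meson card_2_iff)
    then show ?thesis using degree_two_literal_reducible[OF F(1)] c assms(4) by simp
  qed
qed

theorem theorem3:
  shows "\<nexists>F. clause_set F \<and> unsatisfiable F \<and> hitting F \<and> clause_irreducible F \<and>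
           deficiency F = 3 \<and> nfs_irreducible F"
proof
  assume "\<exists>F. clause_set F \<and> unsatisfiable F \<and> hitting F \<and> clause_irreducible F \<and>
           deficiency F = 3 \<and> nfs_irreducible F"
  then obtain F where F: "uhit F" and def: "deficiency F = 3" and irr: "nfs_irreducible F"
    using uhitI by blast
  have d: "card F = card (vars F) + 3" using def by (simp add: deficiency_def)
  have "vars F \<noteq> {}"
  proof
    assume "vars F = {}"
    then have "F \<subseteq> {{}}" by (auto simp: vars_def)
    then have "card F \<le> card {{} :: int set}" by (intro card_mono) auto
    then show False using d by simp
  qed
  then obtain v where m: "min_var F v" using ex_min_var[OF F] by blast
  have v: "v > 0" "v \<in> vars F" using m vars_iff[OF F] by (auto simp: min_var_def)
  have "card (occ F v) \<le> 3" "card (occ F (- v)) \<le> 3"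
    using min_var_occ_le[OF F, of v] min_var_occ_le[OF F, of "- v"] m v d by auto
  moreover have "card (occ F v) \<ge> 1" "card (occ F (- v)) \<ge> 1"
    using occ_nonempty[OF F v(2)] v by auto
  moreover have "card (occ F v) + card (occ F (- v)) \<le> 5"
    using min_var_degree_le_5[OF F d m] card_var_occ[OF F] by simp
  \<comment> \<open>A sum of at most 5 forces one of the two counts down to 2 or less; the double
    negation lets the same lemma serve \<open>- v\<close>.\<close>
  ultimately have "card (occ F v) \<in> {1, 2} \<and> card (occ F (- v)) \<le> 3 \<or>
      card (occ F (- v)) \<in> {1, 2} \<and> card (occ F (- (- v))) \<le> 3" by auto
  then have "nfs_reducible F"
    using low_degree_literal_reducible[OF F, of v] low_degree_literal_reducible[OF F, of "- v"] d by auto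
  then show False using irr by simp
qed

end
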